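(* Let $G=([d],E,B)$ be a $k$-th-order mixed graph whose directed part contains all self-loops, let $M$ be a stable $d\times d$ matrix and $\mathcal{C}$ a $k$-th-order tensor such that $(M,\mathcal{C})$ is compatible with $G$. For $s\ge 0$ let $$\mathcal{K}(s)=\int_0^s\mathcal{C}\times_1e^{Mt}\times_2e^{Mt}\cdots\times_ke^{Mt}\,dt.$$ Then for all $i_1,\dots,i_k\in[d]$ $$(\mathcal{K}(s))_{i_1\dots i_k}=\sum_{\tau\in\mathcal{T}(i_1,\dots,i_k)}\frac{s^{\sum_{j=1}^k\ell_{i_j}(\tau)+1}}{\prod_{j=1}^k\ell_{i_j}(\tau)!\,\left(\sum_{j=1}^k\ell_{i_j}(\tau)+1\right)}\,\omega(M,\mathcal{C},\tau).$$
   Context: A $k$-th-order mixed graph $G=([d],E,B)$ has node set $[d]=\{1,\dots,d\}$, a set $E$ of directed edges (self-loops allowed) and a set $B$ of $k$-fold blunt edges, i.e. unordered $k$-tuples (multisets) of nodes; we write $(j_1,\dots,j_k)\in B$ irrespective of order. $(M,\mathcal{C})$ is compatible with $G$ if $M\in\mathbb{R}^{d\times d}$ satisfies $M_{ij}=0$ whenever $j\to i\notin E$, and $\mathcal{C}$ is a symmetric $k$-th-order $d\times\cdots\times d$ tensor with $\mathcal{C}_{j_1\cdots j_k}=0$ whenever $(j_1,\dots,j_k)\notin B$. Stable means all eigenvalues have negative real part. $(T\times_nN)_{\dots j\dots}=\sum_{i_n}T_{\dots i_n\dots}N_{ji_n}$ is the $n$-mode product. A $k$-trek $\tau$ between (positions)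 $i_1,\dots,i_k$ consists of an ordered tuple of top nodes $(j_1,\dots,j_k)$ forming a blunt edge in $B$ together with directed walks $\pi_m$ in $([d],E)$ from $j_m$ to $i_m$, $m=1,\dots,k$; walks may have length $0$ and may use self-loops and repeat edges. $\ell_{i_m}(\tau)$ is the length of $\pi_m$, and $\mathcal{T}(i_1,\dots,i_k)$ is the set of all such treks. The trek polynomial is $\omega(M,\mathcal{C},\tau)=\mathcal{C}_{j_1\cdots j_k}\prod_{m=1}^k\prod_{\alpha\to\beta\in\pi_m}M_{\beta\alpha}$. *)

theory Defs
  imports "HOL-Analysis.Analysis" "HOL-Library.Multiset" "Graph_Theory.Pair_Digraph"
begin

text \<open>
  The node set \<open>[d]\<close> is a finite type \<open>'v\<close>, with \<open>d\<close> its cardinality. The pair \<open>(j, i)\<close> in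
  \<open>directed G\<close> is the edge \<open>j \<rightarrow> i\<close>. Unordered tuples of nodes are multisets.
\<close>

record 'v mixed_graph =
  directed :: "'v rel"
  blunt :: "'v multiset set"

definition mixed_graph_of_order :: "nat \<Rightarrow> 'v mixed_graph \<Rightarrow> bool" where
  "mixed_graph_of_order k G \<longleftrightarrow> (\<forall>b\<in>blunt G. size b = k)"

definition directed_part :: "'v mixed_graph \<Rightarrow> ('v, 'v \<times> 'v) pre_digraph" where
  "directed_part G = with_proj \<lparr> pverts = UNIV, parcs = directed G \<rparr>"

text \<open>
  A tensor of order \<open>k\<close> is a function on index tuples, encoded as lists; only its values on lists
  of length \<open>k\<close> are meaningful. Positions in a list, hence modes, are counted from \<open>0\<close>.
\<close>

type_synonym 'v tensor = "'v list \<Rightarrow> real"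

definition symmetric_tensor :: "nat \<Rightarrow> 'v tensor \<Rightarrow> bool" where
  "symmetric_tensor k T \<longleftrightarrow>
     (\<forall>js js'. length js = k \<longrightarrow> mset js' = mset js \<longrightarrow> T js' = T js)"

definition mode_product :: "'v tensor \<Rightarrow> nat \<Rightarrow> real^'v^'v \<Rightarrow> 'v::finite tensor" where
  "mode_product T n N = (\<lambda>js. \<Sum>i\<in>UNIV. T (js[n := i]) * N $ (js ! n) $ i)"

definition all_mode_products :: "nat \<Rightarrow> 'v tensor \<Rightarrow> real^'v^'v \<Rightarrow> 'v::finite tensor" where
  "all_mode_products k T N = fold (\<lambda>n S. mode_product S n N) [0..<k] T"

text \<open>
  The library's \<open>*\<close> on \<open>real^'v^'v\<close> acts componentwise, so its generic power and exponential do
  not give the matrix exponential.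
\<close>

definition matrix_power :: "real^'v^'v \<Rightarrow> nat \<Rightarrow> real^'v^'v" where
  "matrix_power A n = (((**) A) ^^ n) (mat 1)"

definition matrix_exp :: "real^'v^'v \<Rightarrow> real^'v^'v" where
  "matrix_exp A = (\<Sum>n. matrix_power A n /\<^sub>R fact n)"

definition stable_matrix :: "real^'v^'v \<Rightarrow> bool" where
  "stable_matrix M \<longleftrightarrow>
     (\<forall>z x. x \<noteq> 0 \<and> map_matrix complex_of_real M *v x = z *s x \<longrightarrow> Re z < 0)"

definition compatible :: "nat \<Rightarrow> 'v mixed_graph \<Rightarrow> real^'v^'v \<Rightarrow> 'v tensor \<Rightarrow> bool" where
  "compatible k G M C \<longleftrightarrow>
     (\<forall>i j. (j, i) \<notin> directed G \<longrightarrow> M $ i $ j = 0) \<and>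
     symmetric_tensor k C \<and>
     (\<forall>js. length js = k \<longrightarrow> mset js \<notin> blunt G \<longrightarrow> C js = 0)"

definition integrated_tensor ::
    "nat \<Rightarrow> real^'v^'v \<Rightarrow> 'v tensor \<Rightarrow> real \<Rightarrow> 'v::finite tensor" where
  "integrated_tensor k M C s =
     (\<lambda>is. integral {0..s} (\<lambda>t. all_mode_products k C (matrix_exp (t *\<^sub>R M)) is))"

text \<open>
  A trek \<open>(js, ps)\<close> consists of the ordered tuple \<open>js\<close> of top nodes and the tuple \<open>ps\<close> of directed
  walks, each given by its list of edges, so that \<open>length\<close> is the length of the walk. The order of
  the trek is the length of the list \<open>is\<close> of end nodes.
\<close>

type_synonym 'v trek = "'v list \<times> ('v \<times> 'v) awalk list"

definition treks :: "'v mixed_graph \<Rightarrow> 'v list \<Rightarrow> 'v trek set" where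
  "treks G is =
     {(js, ps). length js = length is \<and> length ps = length is \<and> mset js \<in> blunt G \<and>
        (\<forall>m<length is. pre_digraph.awalk (directed_part G) (js ! m) (ps ! m) (is ! m))}"

definition walk_length :: "'v trek \<Rightarrow> nat \<Rightarrow> nat" where
  "walk_length \<tau> m = length (snd \<tau> ! m)"

definition trek_polynomial :: "nat \<Rightarrow> real^'v^'v \<Rightarrow> 'v tensor \<Rightarrow> 'v trek \<Rightarrow> real" where
  "trek_polynomial k M C \<tau> =
     C (fst \<tau>) * (\<Prod>m<k. \<Prod>(\<alpha>, \<beta>)\<leftarrow>snd \<tau> ! m. M $ \<beta> $ \<alpha>)"

end

theory Submission
  imports Defs
begin

text \<open>
  Expanding the mode products, the integrand at the index tuple \<open>i\<^sub>1, \<dots>, i\<^sub>k\<close> is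
  \<open>\<Sum> C(j\<^sub>1, \<dots>, j\<^sub>k) \<Prod>\<^sub>m (e^(t M))(i\<^sub>m, j\<^sub>m)\<close>, the sum running over all tuples of top nodes
  (\<open>fold_mode_products\<close>). An entry \<open>(i, j)\<close> of the power \<open>A^n\<close> is the sum of the weights of the
  walks of length \<open>n\<close> from \<open>j\<close> to \<open>i\<close> (\<open>sum_walks_of_length\<close>), so an entry of \<open>e^A\<close> is the sum
  over all walks \<open>p\<close> from \<open>j\<close> to \<open>i\<close> of the weight of \<open>p\<close> divided by \<open>(length p)!\<close>
  (\<open>has_sum_walks_matrix_exp\<close>). This family is absolutely summable, because even the sum over all
  edge sequences is dominated by the exponential series at \<open>r = \<Sum> |A(i, j)|\<close>. Multiplying the walk
  sums out gives a sum over treks (\<open>has_sum_treks_mode_products\<close>). For \<open>A = t M\<close> the summand of a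
  trek of total length \<open>L\<close> is \<open>t^L\<close> times its value at \<open>t = 1\<close>.

  For \<open>0 \<le> t \<le> s\<close> each summand is bounded in absolute value by its value at \<open>t = s\<close>, and these
  bounds are summable. By the Weierstrass M-test the sum converges uniformly on the interval and may
  be integrated term by term (\<open>has_sum_integral\<close>), where \<open>t^L\<close> integrates to
  \<open>s^(L + 1) / (L + 1)\<close>.
\<close>

section \<open>Walks and the entries of matrix powers\<close>

text \<open>The directed walks from \<open>j\<close> to \<open>i\<close>, as lists of edges.\<close>

definition walks :: "'v mixed_graph \<Rightarrow> 'v \<Rightarrow> 'v \<Rightarrow> ('v \<times> 'v) awalk set" where
  "walks G j i = {p. pre_digraph.awalk (directed_part G) j p i}"

text \<open>
  The product of the matrix entries along a walk; the edge \<open>\<alpha> \<rightarrow> \<beta>\<close> contributes the entry in row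
  \<open>\<beta>\<close> and column \<open>\<alpha>\<close>.
\<close>

definition walk_weight :: "real^'v^'v \<Rightarrow> ('v \<times> 'v) awalk \<Rightarrow> real" where
  "walk_weight A p = (\<Prod>(\<alpha>, \<beta>)\<leftarrow>p. A $ \<beta> $ \<alpha>)"

lemma walk_weight_simps [simp]:
  "walk_weight A [] = 1"
  "walk_weight A (e # p) = A $ snd e $ fst e * walk_weight A p"
  "walk_weight A (p @ q) = walk_weight A p * walk_weight A q"
  by (auto simp: walk_weight_def case_prod_beta)

lemma Nil_in_walks_iff [simp]: "[] \<in> walks G j i \<longleftrightarrow> j = i"
  by (simp add: walks_def pre_digraph.awalk_def pre_digraph.cas.simps directed_part_def)

lemma awlast_if_cas: "pre_digraph.cas D u p v \<Longrightarrow> pre_digraph.awlast D u p = v"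
  by (induction p arbitrary: u)
     (auto simp: pre_digraph.cas.simps pre_digraph.awalk_verts.simps pre_digraph.awalk_verts_non_Nil)

lemma snoc_in_walks_iff:
  "p @ [(l, i')] \<in> walks G j i \<longleftrightarrow> p \<in> walks G j l \<and> (l, i) \<in> directed G \<and> i' = i"
  by (auto simp add: walks_def pre_digraph.awalk_def pre_digraph.cas_append_iff
      pre_digraph.cas.simps directed_part_def dest: awlast_if_cas)

lemma sum_lists_of_length:
  fixes h :: "'a::finite \<Rightarrow> 'b::comm_semiring_1"
  shows "(\<Sum>p | length p = n. \<Prod>x\<leftarrow>p. h x) = (\<Sum>x\<in>UNIV. h x) ^ n"
proof (induction n)
  case (Suc n)
  have eq: "{p. length p = Suc n} = (\<lambda>(x, p). x # p) ` (UNIV \<times> {p :: 'a list. length p = n})"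
    by (auto simp: length_Suc_conv image_iff)
  have "(\<Sum>p | length p = Suc n. \<Prod>x\<leftarrow>p. h x)
      = (\<Sum>(x, p)\<in>UNIV \<times> {p. length p = n}. h x * (\<Prod>x\<leftarrow>p. h x))"
    unfolding eq by (subst sum.reindex) (auto simp: inj_on_def case_prod_beta)
  then show ?case
    by (simp add: Suc.IH [symmetric] sum_product sum.cartesian_product)
qed simp

lemma finite_lists_of_length: "finite {p :: 'a::finite list. length p = n}"
  using finite_lists_length_eq [of "UNIV :: 'a set" n] by simp

lemma finite_walks_of_length:
  fixes G :: "'v::finite mixed_graph"
  shows "finite {p \<in> walks G j i. length p = n}"
  by (rule finite_subset [OF _ finite_lists_of_length [of n]]) auto

text \<open>
  The support condition makes the nodes \<open>l\<close> without an edge to \<open>i\<close> contribute nothing to the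
  matrix product, so its sum over all \<open>l\<close> is a sum over the possible last edges of a walk.
\<close>

lemma sum_walks_of_length:
  fixes G :: "'v::finite mixed_graph"
  assumes supp: "\<And>i j. (j, i) \<notin> directed G \<Longrightarrow> A $ i $ j = 0"
  shows "(\<Sum>p | p \<in> walks G j i \<and> length p = n. walk_weight A p) = matrix_power A n $ i $ j"
proof (induction n arbitrary: i)
  case 0
  have "{p. p \<in> walks G j i \<and> length p = 0} = (if i = j then {[]} else {})"
    by auto
  then show ?case
    by (auto simp: matrix_power_def mat_def)
next
  case (Suc n)
  let ?W = "\<lambda>l. {p. p \<in> walks G j l \<and> length p = n}"
  have eq: "{p. p \<in> walks G j i \<and> length p = Suc n}
      = (\<lambda>(l, p). p @ [(l, i)]) ` (SIGMA l:{l. (l, i) \<in> directed G}. ?W l)" (is "?L = ?R")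
  proof
    show "?L \<subseteq> ?R"
    proof
      fix q assume q: "q \<in> ?L"
      then obtain p l i' where "q = p @ [(l, i')]"
        by (cases q rule: rev_cases) auto
      with q show "q \<in> ?R"
        by (force simp: snoc_in_walks_iff)
    qed
  qed (auto simp: snoc_in_walks_iff)
  have "(\<Sum>p | p \<in> walks G j i \<and> length p = Suc n. walk_weight A p)
      = (\<Sum>(l, p)\<in>(SIGMA l:{l. (l, i) \<in> directed G}. ?W l). A $ i $ l * walk_weight A p)"
    unfolding eq by (subst sum.reindex) (auto simp: inj_on_def case_prod_beta mult.commute)
  also have "\<dots> = (\<Sum>l | (l, i) \<in> directed G. \<Sum>p\<in>?W l. A $ i $ l * walk_weight A p)"
    using finite_walks_of_length[of G j _ n] by (subst sum.Sigma) auto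
  also have "\<dots> = (\<Sum>l | (l, i) \<in> directed G. A $ i $ l * matrix_power A n $ l $ j)"
    by (simp add: Suc.IH flip: sum_distrib_left)
  also have "\<dots> = (\<Sum>l\<in>UNIV. A $ i $ l * matrix_power A n $ l $ j)"
    by (rule sum.mono_neutral_left) (auto simp: supp)
  also have "\<dots> = matrix_power A (Suc n) $ i $ j"
    by (simp add: matrix_power_def matrix_matrix_mult_def)
  finally show ?case .
qed

section \<open>The matrix exponential as a sum over walks\<close>

text \<open>
  Summability already holds over all edge sequences, without the condition that consecutive edges
  meet: the absolute weights of the sequences of length \<open>n\<close> then add up to exactly \<open>r^n\<close>, with
  \<open>r\<close> the sum of the absolute values of all matrix entries.
\<close>

lemma summable_walk_weights:
  fixes A :: "real^'v::finite^'v"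
  shows "(\<lambda>(n, p). walk_weight A p / fact n) summable_on (SIGMA n:UNIV. {p. length p = n})"
proof -
  define h where "h = (\<lambda>e. \<bar>A $ snd e $ fst e\<bar>)"
  define r where "r = (\<Sum>e\<in>UNIV. h e)"
  have abs_weight: "\<bar>walk_weight A p\<bar> = (\<Prod>e\<leftarrow>p. h e)" for p
    by (induction p) (auto simp: abs_mult h_def)
  have "(\<lambda>(n, p). (\<Prod>e\<leftarrow>p. h e) / fact n) summable_on (SIGMA n:UNIV. {p. length p = n})"
  proof (rule summable_on_SigmaI [where g = "\<lambda>n. r ^ n / fact n"])
    show "((\<lambda>p. case (n, p) of (n, p) \<Rightarrow> (\<Prod>e\<leftarrow>p. h e) / fact n) has_sum r ^ n / fact n)
            {p. length p = n}" for n :: nat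
      by (intro has_sum_finiteI finite_lists_of_length)
         (simp add: r_def sum_lists_of_length flip: sum_divide_distrib)
    have "summable (\<lambda>n. r ^ n / fact n)"
      using summable_exp [of r] by (simp add: field_simps)
    moreover have "r \<ge> 0"
      by (auto simp: r_def h_def intro!: sum_nonneg)
    ultimately show "(\<lambda>n. r ^ n / fact n) summable_on UNIV"
      by (subst summable_on_UNIV_nonneg_real_iff) auto
  qed (auto simp flip: abs_weight)
  then show ?thesis
    unfolding summable_on_iff_abs_summable_on_real [of "\<lambda>(n, p). walk_weight A p / fact n"]
    by (simp add: case_prod_unfold abs_weight)
qed

text \<open>
  Grouping the walks by length turns the sum into the exponential series of each entry; its
  convergence, needed for \<^const>\<open>matrix_exp\<close> to be meaningful, comes out of the same argument.
\<close>

lemma has_sum_walks_matrix_exp: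
  fixes G :: "'v::finite mixed_graph"
  assumes supp: "\<And>i j. (j, i) \<notin> directed G \<Longrightarrow> A $ i $ j = 0"
  shows "((\<lambda>p. walk_weight A p / fact (length p)) has_sum matrix_exp A $ i $ j) (walks G j i)"
proof -
  let ?f = "\<lambda>(n, p). walk_weight A p / fact n"
  let ?S = "\<lambda>j i. SIGMA n:UNIV. {p \<in> walks G j i. length p = n}"
  define a where "a i j = infsum ?f (?S j i)" for i j
  have a: "(?f has_sum a i j) (?S j i)" for i j
    unfolding a_def
    by (intro has_sum_infsum summable_on_subset [OF summable_walk_weights]) auto
  have entry_sums: "(\<lambda>n. (matrix_power A n /\<^sub>R fact n) $ i $ j) sums a i j" for i j
  proof (rule has_sum_imp_sums, rule has_sum_SigmaD [OF a])
    show "((\<lambda>p. ?f (n, p)) has_sum (matrix_power A n /\<^sub>R fact n) $ i $ j)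
            {p \<in> walks G j i. length p = n}" for n
      by (intro has_sum_finiteI finite_walks_of_length)
         (simp add: sum_walks_of_length [OF supp] divide_inverse mult.commute flip: sum_distrib_left)
  qed
  have "(\<lambda>n. matrix_power A n /\<^sub>R fact n) sums (\<chi> i j. a i j)"
    unfolding sums_def
    by (intro vec_tendstoI) (use entry_sums in \<open>simp add: sums_def\<close>)
  then have "matrix_exp A $ i $ j = a i j"
    unfolding matrix_exp_def by (simp add: sums_iff)
  moreover have "bij_betw (\<lambda>p. (length p, p)) (walks G j i) (?S j i)"
    by (auto simp: bij_betw_def inj_on_def)
  ultimately show ?thesis
    using a[where i = i and j = j] by (simp flip: has_sum_reindex_bij_betw)
qed

section \<open>Products of sums\<close>

lemma has_sum_mult_Times:
  fixes f :: "'a \<Rightarrow> real" and g :: "'b \<Rightarrow> real"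
  assumes f: "(f has_sum a) A" and g: "(g has_sum b) B"
  shows "((\<lambda>(x, y). f x * g y) has_sum a * b) (A \<times> B)"
proof (rule has_sum_SigmaI)
  show "((\<lambda>y. case (x, y) of (x, y) \<Rightarrow> f x * g y) has_sum f x * b) B" for x
    using has_sum_cmult_right [OF g] by simp
  show "((\<lambda>x. f x * b) has_sum a * b) A"
    using has_sum_cmult_left [OF f] .
  \<comment> \<open>For real families summability is absolute summability, which passes to the product.\<close>
  have nf: "(\<lambda>x. \<bar>f x\<bar>) summable_on A" and ng: "(\<lambda>x. \<bar>g x\<bar>) summable_on B"
    using f g summable_on_iff_abs_summable_on_real by (fastforce simp: summable_on_def)+
  have "(\<lambda>(x, y). \<bar>f x\<bar> * \<bar>g y\<bar>) summable_on A \<times> B"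
  proof (rule summable_on_SigmaI)
    show "((\<lambda>y. case (x, y) of (x, y) \<Rightarrow> \<bar>f x\<bar> * \<bar>g y\<bar>) has_sum \<bar>f x\<bar> * infsum (\<lambda>y. \<bar>g y\<bar>) B) B" for x
      using has_sum_cmult_right [OF has_sum_infsum [OF ng]] by simp
    show "(\<lambda>x. \<bar>f x\<bar> * infsum (\<lambda>y. \<bar>g y\<bar>) B) summable_on A"
      by (rule summable_on_cmult_left [OF nf])
  qed auto
  then show "(\<lambda>(x, y). f x * g y) summable_on A \<times> B"
    unfolding summable_on_iff_abs_summable_on_real [of "\<lambda>(x, y). f x * g y"]
    by (simp add: case_prod_unfold abs_mult)
qed

lemma has_sum_prod_lists:
  fixes f :: "nat \<Rightarrow> 'a \<Rightarrow> real"
  assumes "\<And>m. m < k \<Longrightarrow> (f m has_sum S m) (A m)"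
  shows "((\<lambda>ps. \<Prod>m<k. f m (ps ! m)) has_sum (\<Prod>m<k. S m))
           {ps. length ps = k \<and> (\<forall>m<k. ps ! m \<in> A m)}"
  using assms
proof (induction k)
  case 0
  have "{ps :: 'a list. length ps = 0 \<and> (\<forall>m<0. ps ! m \<in> A m)} = {[]}"
    by auto
  then show ?case
    by (simp add: has_sum_finiteI)
next
  case (Suc k)
  let ?L = "\<lambda>k. {ps. length ps = k \<and> (\<forall>m<k. ps ! m \<in> A m)}"
  have "((\<lambda>(ps, p). (\<Prod>m<k. f m (ps ! m)) * f k p) has_sum (\<Prod>m<k. S m) * S k) (?L k \<times> A k)"
    by (intro has_sum_mult_Times Suc) auto
  also have "?this \<longleftrightarrow> ((\<lambda>ps. \<Prod>m<Suc k. f m (ps ! m)) has_sum (\<Prod>m<k. S m) * S k) (?L (Suc k))"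
  proof (rule has_sum_reindex_bij_witness [where j = "\<lambda>(ps, p). ps @ [p]" and i = "\<lambda>ps. (butlast ps, last ps)"])
    fix ps assume "ps \<in> ?L (Suc k)"
    then show "(case (butlast ps, last ps) of (ps, p) \<Rightarrow> ps @ [p]) = ps"
      and "(butlast ps, last ps) \<in> ?L k \<times> A k"
      by (cases ps rule: rev_cases; force simp: nth_append split: if_splits)+
  qed (auto simp: nth_append less_Suc_eq)
  finally show ?case
    by simp
qed

section \<open>The mode products as a sum over treks\<close>

text \<open>
  Only the first \<open>n\<close> modes are multiplied, so the remaining indices are those of the argument; this
  partial form is what the induction needs.
\<close>

lemma fold_mode_products:
  fixes T :: "'v::finite tensor"
  assumes "n \<le> length is"
  shows "fold (\<lambda>n S. mode_product S n N) [0..<n] T is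
       = (\<Sum>js | length js = n. T (js @ drop n is) * (\<Prod>m<n. N $ (is ! m) $ (js ! m)))"
  using assms
proof (induction n arbitrary: "is")
  case (Suc n)
  let ?P = "\<lambda>js n. \<Prod>m<n. N $ (is ! m) $ (js ! m)"
  have eq: "{js :: 'v list. length js = Suc n} = (\<lambda>(i, js). js @ [i]) ` (UNIV \<times> {js. length js = n})"
    by (auto simp: image_iff length_Suc_conv_rev)
  have "(\<Sum>js | length js = Suc n. T (js @ drop (Suc n) is) * ?P js (Suc n))
      = (\<Sum>(i, js)\<in>UNIV \<times> {js. length js = n}.
          T (js @ i # drop (Suc n) is) * (?P (js @ [i]) (Suc n)))"
    unfolding eq by (subst sum.reindex) (auto simp: inj_on_def case_prod_beta)
  also have "\<dots> = (\<Sum>i\<in>UNIV. \<Sum>js | length js = n.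
          T (js @ i # drop (Suc n) is) * (?P js n * N $ (is ! n) $ i))"
    by (simp add: sum.cartesian_product [symmetric] nth_append)
  also have "\<dots> = (\<Sum>i\<in>UNIV. (\<Sum>js | length js = n.
          T (js @ drop n (is[n := i])) * (\<Prod>m<n. N $ (is[n := i] ! m) $ (js ! m))) * N $ (is ! n) $ i)"
  proof (rule sum.cong [OF refl])
    fix i
    have "drop n (is[n := i]) = i # drop (Suc n) is"
      using Suc.prems by (simp add: drop_update_swap Cons_nth_drop_Suc [symmetric])
    then show "(\<Sum>js | length js = n. T (js @ i # drop (Suc n) is) * (?P js n * N $ (is ! n) $ i))
      = (\<Sum>js | length js = n.
          T (js @ drop n (is[n := i])) * (\<Prod>m<n. N $ (is[n := i] ! m) $ (js ! m))) * N $ (is ! n) $ i"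
      by (simp add: sum_distrib_right mult.assoc)
  qed
  also have "\<dots> = fold (\<lambda>n S. mode_product S n N) [0..<Suc n] T is"
    using Suc by (simp add: mode_product_def)
  finally show ?case by simp
qed simp

lemma has_sum_treks_mode_products:
  fixes G :: "'v::finite mixed_graph"
  assumes supp: "\<And>i j. (j, i) \<notin> directed G \<Longrightarrow> A $ i $ j = 0"
    and C: "\<And>js. length js = k \<Longrightarrow> mset js \<notin> blunt G \<Longrightarrow> C js = 0"
    and len: "length is = k"
  shows "((\<lambda>\<tau>. trek_polynomial k A C \<tau> / (\<Prod>m<k. fact (walk_length \<tau> m)))
           has_sum all_mode_products k C (matrix_exp A) is) (treks G is)"
proof -
  let ?J = "{js. length js = k \<and> mset js \<in> blunt G}"
  let ?P = "\<lambda>js. {ps. length ps = k \<and> (\<forall>m<k. ps ! m \<in> walks G (js ! m) (is ! m))}"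
  let ?s = "\<lambda>js. C js * (\<Prod>m<k. matrix_exp A $ (is ! m) $ (js ! m))"
  have treks_eq: "treks G is = Sigma ?J ?P"
    by (auto simp: treks_def walks_def len)
  \<comment> \<open>There are finitely many top tuples, so only the walks require a convergence argument.\<close>
  have fin: "finite ?J"
    by (rule finite_subset [OF _ finite_lists_of_length [of k]]) auto
  have inner: "((\<lambda>ps. trek_polynomial k A C (js, ps) / (\<Prod>m<k. fact (walk_length (js, ps) m)))
                 has_sum ?s js) (?P js)" for js
    using has_sum_cmult_right [OF has_sum_prod_lists
        [of k "\<lambda>m p. walk_weight A p / fact (length p)"
          "\<lambda>m. walks G (js ! m) (is ! m)" "\<lambda>m. matrix_exp A $ (is ! m) $ (js ! m)",
          OF has_sum_walks_matrix_exp [OF supp]], of "C js"]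
    by (simp add: trek_polynomial_def walk_length_def prod_dividef flip: walk_weight_def)
  have "((\<lambda>\<tau>. trek_polynomial k A C \<tau> / (\<Prod>m<k. fact (walk_length \<tau> m))) has_sum sum ?s ?J)
         (\<Union>js\<in>?J. {js} \<times> ?P js)"
  proof (rule sum_has_sum [OF fin])
    fix js
    have "bij_betw (Pair js) (?P js) ({js} \<times> ?P js)"
      by (auto simp: bij_betw_def inj_on_def)
    from inner [of js]
      has_sum_reindex_bij_betw [OF this, of "\<lambda>\<tau>. trek_polynomial k A C \<tau> / (\<Prod>m<k. fact (walk_length \<tau> m))"]
    show "((\<lambda>\<tau>. trek_polynomial k A C \<tau> / (\<Prod>m<k. fact (walk_length \<tau> m)))
            has_sum ?s js) ({js} \<times> ?P js)"
      by simp
  qed auto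
  also have "(\<Union>js\<in>?J. {js} \<times> ?P js) = treks G is"
    by (auto simp: treks_eq)
  also have "sum ?s ?J = all_mode_products k C (matrix_exp A) is"
    unfolding all_mode_products_def using len
    by (subst fold_mode_products) (auto intro!: sum.mono_neutral_left finite_lists_of_length
        dest: C [folded len])
  finally show ?thesis .
qed

lemma walk_weight_scaleR:
  "walk_weight (t *\<^sub>R M) p = t ^ length p * walk_weight M p"
  by (induction p) (auto simp: mult_ac)

lemma trek_polynomial_scaleR:
  "trek_polynomial k (t *\<^sub>R M) C \<tau> = t ^ (\<Sum>m<k. walk_length \<tau> m) * trek_polynomial k M C \<tau>"
  unfolding trek_polynomial_def walk_weight_def [symmetric]
  by (simp add: walk_weight_scaleR prod.distrib walk_length_def power_sum)

section \<open>Termwise integration\<close>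

lemma has_sum_integral:
  fixes f :: "'a \<Rightarrow> real \<Rightarrow> real"
  assumes hs: "\<And>t. t \<in> {a..b} \<Longrightarrow> ((\<lambda>x. f x t) has_sum g t) X"
    and cont: "\<And>x. x \<in> X \<Longrightarrow> continuous_on {a..b} (f x)"
    and bound: "\<And>x t. x \<in> X \<Longrightarrow> t \<in> {a..b} \<Longrightarrow> \<bar>f x t\<bar> \<le> B x"
    and B: "B summable_on X"
  shows "((\<lambda>x. integral {a..b} (f x)) has_sum integral {a..b} g) X"
proof -
  let ?F = "\<lambda>Y t. \<Sum>x\<in>Y \<inter> X. f x t"
  \<comment> \<open>Intersecting with \<open>X\<close> makes every \<open>?F Y\<close> continuous, also for \<open>Y\<close> not contained in \<open>X\<close>.\<close>
  have ev: "eventually (\<lambda>Y. Y \<inter> X = Y \<and> finite Y) (finite_subsets_at_top X)"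
    by (rule eventually_finite_subsets_at_top_weakI) auto
  have "uniform_limit {a..b} (\<lambda>Y t. \<Sum>x\<in>Y. f x t) g (finite_subsets_at_top X)"
    by (rule Weierstrass_m_test_general' [OF _ hs B]) (use bound in auto)
  also have "?this \<longleftrightarrow> uniform_limit {a..b} ?F g (finite_subsets_at_top X)"
    by (rule uniform_limit_cong) (use ev in \<open>auto elim: eventually_mono\<close>)
  finally obtain I J where
    I: "\<And>Y. (?F Y has_integral I Y) {a..b}" and
    J: "(g has_integral J) {a..b}" and lim: "(I \<longlongrightarrow> J) (finite_subsets_at_top X)"
    by (rule uniform_limit_integral) (auto intro!: continuous_intros cont)
  have I_eq: "I Y = (\<Sum>x\<in>Y. integral {a..b} (f x))" if "Y \<inter> X = Y \<and> finite Y" for Y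
  proof (rule has_integral_unique [OF I])
    show "(?F Y has_integral (\<Sum>x\<in>Y. integral {a..b} (f x))) {a..b}"
      using that by (auto intro!: has_integral_sum integrable_integral integrable_continuous_real cont)
  qed
  have "((\<lambda>Y. \<Sum>x\<in>Y. integral {a..b} (f x)) \<longlongrightarrow> J) (finite_subsets_at_top X)"
    by (rule Lim_transform_eventually [OF lim eventually_mono [OF ev I_eq]])
  then show ?thesis
    using J by (simp add: has_sum_def integral_unique)
qed

lemma integral_monomial:
  fixes c s :: real
  assumes "s \<ge> 0"
  shows "integral {0..s} (\<lambda>t. t ^ n * c) = s ^ (n + 1) / (real n + 1) * c"
proof (rule integral_unique)
  have "((\<lambda>t. t ^ n * c) has_integral s ^ (n + 1) / (real n + 1) * c - 0 ^ (n + 1) / (real n + 1) * c) {0..s}"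
  proof (rule fundamental_theorem_of_calculus [OF assms])
    fix t assume "t \<in> {0..s}"
    show "((\<lambda>t. t ^ (n + 1) / (real n + 1) * c) has_vector_derivative t ^ n * c) (at t within {0..s})"
      unfolding has_real_derivative_iff_has_vector_derivative [symmetric]
      by (rule derivative_eq_intros refl | simp)+ (simp add: divide_simps)
  qed
  then show "((\<lambda>t. t ^ n * c) has_integral s ^ (n + 1) / (real n + 1) * c) {0..s}"
    by simp
qed

theorem propositionB2:
  fixes G :: "'v::finite mixed_graph" and M :: "real^'v^'v" and C :: "'v tensor"
    and k :: nat and s :: real
  assumes "mixed_graph_of_order k G"
    and "\<And>v. (v, v) \<in> directed G"
    and "stable_matrix M"
    and "compatible k G M C"
    and "s \<ge> 0"
  shows "\<forall>is. length is = k \<longrightarrow>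
    ((\<lambda>\<tau>. s ^ ((\<Sum>m<k. walk_length \<tau> m) + 1) /
           ((\<Prod>m<k. fact (walk_length \<tau> m)) * (real (\<Sum>m<k. walk_length \<tau> m) + 1)) *
           trek_polynomial k M C \<tau>)
     has_sum integrated_tensor k M C s is) (treks G is)"
proof (intro allI impI)
  fix "is" :: "'v list"
  assume len: "length is = k"
  have supp: "\<And>i j. (j, i) \<notin> directed G \<Longrightarrow> M $ i $ j = 0"
    and C: "\<And>js. length js = k \<Longrightarrow> mset js \<notin> blunt G \<Longrightarrow> C js = 0"
    using \<open>compatible k G M C\<close> by (auto simp: compatible_def)
  define L where "L = (\<lambda>\<tau> :: 'v trek. \<Sum>m<k. walk_length \<tau> m)"
  define c where "c = (\<lambda>\<tau>. trek_polynomial k M C \<tau> / (\<Prod>m<k. fact (walk_length \<tau> m)))"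
  have hs: "((\<lambda>\<tau>. t ^ L \<tau> * c \<tau>) has_sum all_mode_products k C (matrix_exp (t *\<^sub>R M)) is) (treks G is)" for t
    using has_sum_treks_mode_products [of G "t *\<^sub>R M" k C "is", OF _ C len] supp
    by (simp add: trek_polynomial_scaleR L_def c_def)
  have "((\<lambda>\<tau>. integral {0..s} (\<lambda>t. t ^ L \<tau> * c \<tau>)) has_sum
          integral {0..s} (\<lambda>t. all_mode_products k C (matrix_exp (t *\<^sub>R M)) is)) (treks G is)"
  proof (rule has_sum_integral)
    show "(\<lambda>\<tau>. \<bar>s ^ L \<tau> * c \<tau>\<bar>) summable_on treks G is"
      using hs [of s] summable_on_iff_abs_summable_on_real by (fastforce simp: summable_on_def)
    show "\<bar>t ^ L \<tau> * c \<tau>\<bar> \<le> \<bar>s ^ L \<tau> * c \<tau>\<bar>" if "t \<in> {0..s}" for \<tau> t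
      using that by (auto simp: abs_mult power_abs intro!: mult_right_mono power_mono)
  qed (auto intro!: continuous_intros hs)
  then show "((\<lambda>\<tau>. s ^ ((\<Sum>m<k. walk_length \<tau> m) + 1) /
           ((\<Prod>m<k. fact (walk_length \<tau> m)) * (real (\<Sum>m<k. walk_length \<tau> m) + 1)) *
           trek_polynomial k M C \<tau>)
     has_sum integrated_tensor k M C s is) (treks G is)"
    unfolding integral_monomial [OF \<open>s \<ge> 0\<close>] integrated_tensor_def
    by (simp add: c_def L_def mult_ac del: of_nat_sum)
qed

end
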